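(* For every inverse semigroup $S$ with zero there exists a singly aligned left cancellative small category $\mathcal{C}$ such that $S$ is Morita equivalent to the zigzag inverse semigroup $\mathrm{ZM}(\mathcal{C})$.
   Context: Categories. A small category $\mathcal{C}$ (possibly empty) is identified with its set of morphisms; $\mathcal{C}^0$ is the set of objects, each object being identified with its identity morphism; $r,s:\mathcal{C}\to\mathcal{C}^0$ are the range and source maps, and $\alpha\beta$ is defined if and only if $s(\alpha)=r(\beta)$. For $\alpha\in\mathcal{C}$, $\alpha\mathcal{C}=\{\alpha\beta:\beta\in\mathcal{C},\ s(\alpha)=r(\beta)\}$. $\mathcal{C}$ is left cancellative if $\alpha\beta=\alpha\gamma$ (both products defined) implies $\beta=\gamma$. A left cancellative small category $\mathcal{C}$ is singly aligned if whenever $\alpha\mathcal{C}\cap\beta\mathcal{C}\neq\emptyset$ there is $\gamma\in\mathcal{C}$ with $\alpha\mathcal{C}\cap\beta\mathcal{C}=\gamma\mathcal{C}$. Zigzag inverse semigroup. Let $\mathcal{C}$ be a left cancellative small category. $I(\mathcal{C})$ is the inverse semigroup of all partial bijections of the set $\mathcal{C}$ under composition on the largest possible domain, with $0$ the empty map. For $\alpha\in\mathcal{C}$ let $\tau_\alpha:s(\alpha)\mathcal{C}\to\alpha\mathcal{C}$, $\tau_\alpha(x)=\alpha x$. A zigzag in $\mathcal{C}$ is a tuple $\zeta=(\alpha_1,\beta_1,\dots,\alpha_n,\beta_n)$ ($n\ge 1$) of elements of $\mathcal{C}$ with $r(\alpha_i)=r(\beta_i)$ for $1\le i\le n$ and $s(\beta_i)=s(\alpha_{i+1})$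 for $1\le i\le n-1$; its zigzag map is $\phi_\zeta=\tau_{\alpha_1}^{-1}\tau_{\beta_1}\cdots\tau_{\alpha_n}^{-1}\tau_{\beta_n}\in I(\mathcal{C})$. $\mathrm{ZM}(\mathcal{C})$ is the inverse subsemigroup of $I(\mathcal{C})$ consisting of all zigzag maps and the empty map $0$. Morita equivalence. Inverse semigroups $S$ and $T$ are (strongly) Morita equivalent, in the standard sense of Steinberg, if there is a set $X$ with commuting left $S$-action and right $T$-action and surjective maps $\langle\cdot,\cdot\rangle:X\times X\to S$ and $[\cdot,\cdot]:X\times X\to T$ such that for all $x,y,z\in X$, $s\in S$, $t\in T$: $\langle sx,y\rangle=s\langle x,y\rangle$; $\langle y,x\rangle=\langle x,y\rangle^*$; $\langle x,x\rangle x=x$; $[x,yt]=[x,y]t$; $[y,x]=[x,y]^*$; $x[x,x]=x$; and $\langle x,y\rangle z=x[y,z]$. *)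

theory Defs
  imports "HOL-Algebra.Congruence"
begin

section \<open>Inverse semigroups\<close>

record 'a semigrp = "'a partial_object" +
  mult :: "'a \<Rightarrow> 'a \<Rightarrow> 'a"  (infixl \<open>\<cdot>\<index>\<close> 70)

definition is_inverse :: "('a, 'm) semigrp_scheme \<Rightarrow> 'a \<Rightarrow> 'a \<Rightarrow> bool" where
  "is_inverse S x y \<longleftrightarrow> y \<in> carrier S \<and> x \<cdot>\<^bsub>S\<^esub> y \<cdot>\<^bsub>S\<^esub> x = x \<and> y \<cdot>\<^bsub>S\<^esub> x \<cdot>\<^bsub>S\<^esub> y = y"

definition star :: "('a, 'm) semigrp_scheme \<Rightarrow> 'a \<Rightarrow> 'a" where
  "star S x = (THE y. is_inverse S x y)"

locale inverse_semigroup =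
  fixes S (structure)
  assumes mult_closed: "\<lbrakk>x \<in> carrier S; y \<in> carrier S\<rbrakk> \<Longrightarrow> x \<cdot> y \<in> carrier S"
    and mult_assoc: "\<lbrakk>x \<in> carrier S; y \<in> carrier S; z \<in> carrier S\<rbrakk> \<Longrightarrow> x \<cdot> y \<cdot> z = x \<cdot> (y \<cdot> z)"
    and ex1_inverse: "x \<in> carrier S \<Longrightarrow> \<exists>!y. is_inverse S x y"

locale inverse_semigroup_with_zero = inverse_semigroup +
  assumes ex_zero: "\<exists>z\<in>carrier S. \<forall>x\<in>carrier S. z \<cdot> x = z \<and> x \<cdot> z = z"

section \<open>Morita equivalence of inverse semigroups\<close>

text \<open>Here \<open>lact\<close> and \<open>ract\<close> are the two actions, \<open>lip\<close> is the \<open>S\<close>-valued pairing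
  \<open>\<langle>_,_\<rangle>\<close> and \<open>rip\<close> is the \<open>T\<close>-valued pairing \<open>[_,_]\<close>.\<close>

locale morita_context =
  S: inverse_semigroup S + T: inverse_semigroup T
  for S :: "('a, 'm) semigrp_scheme" and T :: "('b, 'n) semigrp_scheme" +
  fixes X :: "'x set"
    and lact :: "'a \<Rightarrow> 'x \<Rightarrow> 'x"
    and ract :: "'x \<Rightarrow> 'b \<Rightarrow> 'x"
    and lip :: "'x \<Rightarrow> 'x \<Rightarrow> 'a"
    and rip :: "'x \<Rightarrow> 'x \<Rightarrow> 'b"
  assumes lact_closed: "\<lbrakk>s \<in> carrier S; x \<in> X\<rbrakk> \<Longrightarrow> lact s x \<in> X"
    and lact_mult: "\<lbrakk>s \<in> carrier S; s' \<in> carrier S; x \<in> X\<rbrakk>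
          \<Longrightarrow> lact (s \<cdot>\<^bsub>S\<^esub> s') x = lact s (lact s' x)"
    and ract_closed: "\<lbrakk>x \<in> X; t \<in> carrier T\<rbrakk> \<Longrightarrow> ract x t \<in> X"
    and ract_mult: "\<lbrakk>x \<in> X; t \<in> carrier T; t' \<in> carrier T\<rbrakk>
          \<Longrightarrow> ract x (t \<cdot>\<^bsub>T\<^esub> t') = ract (ract x t) t'"
    and act_commute: "\<lbrakk>s \<in> carrier S; x \<in> X; t \<in> carrier T\<rbrakk>
          \<Longrightarrow> ract (lact s x) t = lact s (ract x t)"
    and lip_surj: "(\<lambda>(x, y). lip x y) ` (X \<times> X) = carrier S"
    and rip_surj: "(\<lambda>(x, y). rip x y) ` (X \<times> X) = carrier T"
    and lip_lact: "\<lbrakk>s \<in> carrier S; x \<in> X; y \<in> X\<rbrakk> \<Longrightarrow> lip (lact s x) y = s \<cdot>\<^bsub>S\<^esub> lip x y"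
    and lip_star: "\<lbrakk>x \<in> X; y \<in> X\<rbrakk> \<Longrightarrow> lip y x = star S (lip x y)"
    and lip_self: "x \<in> X \<Longrightarrow> lact (lip x x) x = x"
    and rip_ract: "\<lbrakk>x \<in> X; y \<in> X; t \<in> carrier T\<rbrakk> \<Longrightarrow> rip x (ract y t) = rip x y \<cdot>\<^bsub>T\<^esub> t"
    and rip_star: "\<lbrakk>x \<in> X; y \<in> X\<rbrakk> \<Longrightarrow> rip y x = star T (rip x y)"
    and rip_self: "x \<in> X \<Longrightarrow> ract x (rip x x) = x"
    and lip_rip: "\<lbrakk>x \<in> X; y \<in> X; z \<in> X\<rbrakk> \<Longrightarrow> lact (lip x y) z = ract x (rip y z)"

text \<open>HOL cannot quantify existentially over the type of \<open>X\<close>. Taking \<open>X\<close> to be a set of pairs is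
  no restriction: an arbitrary \<open>X\<close> embeds into \<open>S \<times> T\<close>, which is lemma
  \<open>morita_equivalentI\<close> below.\<close>

definition morita_equivalent ::
    "('a, 'm) semigrp_scheme \<Rightarrow> ('b, 'n) semigrp_scheme \<Rightarrow> bool" where
  "morita_equivalent S T \<longleftrightarrow>
     (\<exists>(X :: ('a \<times> 'b) set) lact ract lip rip. morita_context S T X lact ract lip rip)"

lemma morita_equivalentI:
  fixes X :: "'x set"
  assumes "morita_context S T X lact ract lip rip"
  shows "morita_equivalent S T"
proof -
  interpret morita_context S T X lact ract lip rip by fact
  define rep where "rep e = (SOME x. x \<in> X \<and> lip x x = e)" for e
  define f where "f y = (lip y y, rip (rep (lip y y)) y)" for y
  have rep: "rep (lip y y) \<in> X \<and> lip (rep (lip y y)) (rep (lip y y)) = lip y y" if "y \<in> X" for y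
    unfolding rep_def by (rule someI[of _ y]) (simp add: that)
  have recover: "y = ract (rep (lip y y)) (rip (rep (lip y y)) y)" if "y \<in> X" for y
    using lip_rip[of "rep (lip y y)" "rep (lip y y)" y] rep[OF that] lip_self[OF that] that
    by simp
  have inj: "inj_on f X"
  proof (rule inj_onI)
    fix y z assume "y \<in> X" "z \<in> X" "f y = f z"
    then show "y = z" using recover unfolding f_def by (metis prod.inject)
  qed
  define g where "g = inv_into X f"
  have gf [simp]: "g (f x) = x" if "x \<in> X" for x
    unfolding g_def using inj that by simp
  have lipX: "lip x y \<in> carrier S" and ripX: "rip x y \<in> carrier T" if "x \<in> X" "y \<in> X" for x y
    using that lip_surj rip_surj by fast+
  have "morita_context S T (f ` X) (\<lambda>s x. f (lact s (g x))) (\<lambda>x t. f (ract (g x) t))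
          (\<lambda>x y. lip (g x) (g y)) (\<lambda>x y. rip (g x) (g y))"
  proof unfold_locales
    show "(\<lambda>(x, y). lip (g x) (g y)) ` (f ` X \<times> f ` X) = carrier S"
      and "(\<lambda>(x, y). rip (g x) (g y)) ` (f ` X \<times> f ` X) = carrier T"
      unfolding lip_surj[symmetric] rip_surj[symmetric] by (force simp: image_iff)+
  qed (auto simp: lact_closed ract_closed lact_mult ract_mult act_commute lip_lact lip_self
        rip_ract rip_self lip_rip intro: lip_star rip_star)
  then show ?thesis unfolding morita_equivalent_def by blast
qed

section \<open>Small categories\<close>

text \<open>A small category is its set of morphisms, objects being identified with their identity
  morphisms. So \<open>rng\<close> and \<open>src\<close> take values in the morphisms, and the objects are the morphisms
  fixed by them. The product \<open>cmp C a b\<close> is meaningful only if \<open>src C a = rng C b\<close>.\<close>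

record 'c cat =
  mor :: "'c set"
  rng :: "'c \<Rightarrow> 'c"
  src :: "'c \<Rightarrow> 'c"
  cmp :: "'c \<Rightarrow> 'c \<Rightarrow> 'c"

locale small_category =
  fixes C :: "('c, 'm) cat_scheme"
  assumes rng_mor: "a \<in> mor C \<Longrightarrow> rng C a \<in> mor C"
    and src_mor: "a \<in> mor C \<Longrightarrow> src C a \<in> mor C"
    and rng_rng: "a \<in> mor C \<Longrightarrow> rng C (rng C a) = rng C a"
    and src_rng: "a \<in> mor C \<Longrightarrow> src C (rng C a) = rng C a"
    and rng_src: "a \<in> mor C \<Longrightarrow> rng C (src C a) = src C a"
    and src_src: "a \<in> mor C \<Longrightarrow> src C (src C a) = src C a"
    and cmp_mor: "\<lbrakk>a \<in> mor C; b \<in> mor C; src C a = rng C b\<rbrakk> \<Longrightarrow> cmp C a b \<in> mor C"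
    and rng_cmp: "\<lbrakk>a \<in> mor C; b \<in> mor C; src C a = rng C b\<rbrakk> \<Longrightarrow> rng C (cmp C a b) = rng C a"
    and src_cmp: "\<lbrakk>a \<in> mor C; b \<in> mor C; src C a = rng C b\<rbrakk> \<Longrightarrow> src C (cmp C a b) = src C b"
    and cmp_assoc: "\<lbrakk>a \<in> mor C; b \<in> mor C; c \<in> mor C; src C a = rng C b; src C b = rng C c\<rbrakk>
          \<Longrightarrow> cmp C (cmp C a b) c = cmp C a (cmp C b c)"
    and rng_cmp_left: "a \<in> mor C \<Longrightarrow> cmp C (rng C a) a = a"
    and src_cmp_right: "a \<in> mor C \<Longrightarrow> cmp C a (src C a) = a"

definition right_ideal :: "('c, 'm) cat_scheme \<Rightarrow> 'c \<Rightarrow> 'c set" where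
  "right_ideal C a = {cmp C a b | b. b \<in> mor C \<and> src C a = rng C b}"

locale left_cancellative_category = small_category +
  assumes left_cancel:
    "\<lbrakk>a \<in> mor C; b \<in> mor C; c \<in> mor C; src C a = rng C b; src C a = rng C c;
      cmp C a b = cmp C a c\<rbrakk> \<Longrightarrow> b = c"

locale singly_aligned_category = left_cancellative_category +
  assumes singly_aligned:
    "\<lbrakk>a \<in> mor C; b \<in> mor C; right_ideal C a \<inter> right_ideal C b \<noteq> {}\<rbrakk>
      \<Longrightarrow> \<exists>c\<in>mor C. right_ideal C a \<inter> right_ideal C b = right_ideal C c"

section \<open>The inverse semigroup of zigzag maps\<close>

definition partial_bijections :: "'c set \<Rightarrow> ('c \<rightharpoonup> 'c) semigrp" where
  "partial_bijections A =
     \<lparr>carrier = {f. dom f \<subseteq> A \<and> ran f \<subseteq> A \<and> inj_on f (dom f)}, mult = (\<circ>\<^sub>m)\<rparr>"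

definition pinverse :: "('c \<rightharpoonup> 'c) \<Rightarrow> ('c \<rightharpoonup> 'c)" where
  "pinverse f = (\<lambda>y. if y \<in> ran f then Some (THE x. f x = Some y) else None)"

definition tau :: "('c, 'm) cat_scheme \<Rightarrow> 'c \<Rightarrow> ('c \<rightharpoonup> 'c)" where
  "tau C a = (\<lambda>x. if x \<in> right_ideal C (src C a) then Some (cmp C a x) else None)"

text \<open>The tuple \<open>(\<alpha>\<^sub>1, \<beta>\<^sub>1, \<dots>, \<alpha>\<^sub>n, \<beta>\<^sub>n)\<close> is the list of pairs \<open>[(\<alpha>\<^sub>1, \<beta>\<^sub>1), \<dots>, (\<alpha>\<^sub>n, \<beta>\<^sub>n)]\<close>.\<close>

definition zigzag :: "('c, 'm) cat_scheme \<Rightarrow> ('c \<times> 'c) list \<Rightarrow> bool" where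
  "zigzag C zs \<longleftrightarrow> zs \<noteq> []
     \<and> (\<forall>(a, b) \<in> set zs. a \<in> mor C \<and> b \<in> mor C \<and> rng C a = rng C b)
     \<and> (\<forall>i. Suc i < length zs \<longrightarrow> src C (snd (zs ! i)) = src C (fst (zs ! Suc i)))"

text \<open>The total identity map \<open>Some\<close> only starts the fold: a zigzag is nonempty, and
  \<open>f \<circ>\<^sub>m Some = f\<close>.\<close>

definition zigzag_map :: "('c, 'm) cat_scheme \<Rightarrow> ('c \<times> 'c) list \<Rightarrow> ('c \<rightharpoonup> 'c)" where
  "zigzag_map C zs = foldr (\<lambda>(a, b) f. pinverse (tau C a) \<circ>\<^sub>m tau C b \<circ>\<^sub>m f) zs Some"

definition ZM :: "('c, 'm) cat_scheme \<Rightarrow> ('c \<rightharpoonup> 'c) semigrp" where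
  "ZM C = (partial_bijections (mor C))
     \<lparr>carrier := {zigzag_map C zs | zs. zigzag C zs} \<union> {Map.empty}\<rparr>"

end

theory Submission
  imports Defs
begin

text \<open>
  Write \<open>E\<close> for the idempotents of \<open>S\<close>. The category is the one attached to \<open>S\<close> by Loganathan, with
  the zero removed: its morphisms are the pairs \<open>(e, s)\<close> with \<open>e \<in> E\<close>, \<open>s \<noteq> 0\<close> and \<open>e s = s\<close>, going
  from the object \<open>s\<^sup>* s\<close> to the object \<open>e\<close>, with \<open>(e, s) (f, t) = (e, s t)\<close>. Cancelling \<open>s\<close> on the left
  amounts to multiplying by \<open>s\<^sup>*\<close>. The right ideal of \<open>(e, s)\<close> consists of the pairs \<open>(e, u)\<close> with
  \<open>u \<noteq> 0\<close> and \<open>s s\<^sup>* u = u\<close>. So right ideals of morphisms with different ranges are disjoint, and those of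
  \<open>(e, s)\<close> and \<open>(e, t)\<close> meet in the right ideal of \<open>(e, g)\<close>, where \<open>g\<close> is the product of the idempotents
  \<open>s s\<^sup>*\<close> and \<open>t t\<^sup>*\<close>, or not at all if \<open>g = 0\<close>; this is single alignment.

  For the Morita equivalence everything is made a composite of two kinds of partial injection. The
  map \<open>\<lambda>\<^sub>s\<close> is the Wagner--Preston map \<open>x \<mapsto> s x\<close>, defined on the nonzero \<open>x\<close> with
  \<open>s\<^sup>* s x = x\<close>; it represents \<open>S\<close> faithfully. The map \<open>\<epsilon>\<^sub>q\<close> is the projection \<open>(q, x) \<mapsto> x\<close> from
  the fibre of the category over the object \<open>q\<close> into \<open>S\<close>. Distinct fibres are disjoint, so
  \<open>\<epsilon>\<^sub>q \<epsilon>\<^sub>r\<^sup>-\<^sup>1\<close> is \<open>\<lambda>\<^sub>q\<close> if \<open>q = r\<close> and empty otherwise. Let \<open>X\<close> be the set of all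
  \<open>\<lambda>\<^sub>a \<epsilon>\<^sub>q\<close>. Then \<open>X X\<^sup>-\<^sup>1\<close> is the set of all \<open>\<lambda>\<^sub>s\<close>, a copy of \<open>S\<close>, while \<open>X\<^sup>-\<^sup>1 X\<close> is the set
  of all \<open>\<epsilon>\<^sub>p\<^sup>-\<^sup>1 \<lambda>\<^sub>c \<epsilon>\<^sub>q\<close>.

  These last maps are exactly the zigzag maps and the empty map. In fact \<open>\<tau>\<close> of \<open>(e, s)\<close> is
  \<open>\<lambda>\<^sub>s \<epsilon>\<^sub>q\<close>, with \<open>q = s\<^sup>* s\<close>, followed by the injection \<open>x \<mapsto> (e, x)\<close>. That injection cancels in
  \<open>\<tau>\<^sub>\<alpha>\<^sup>-\<^sup>1 \<tau>\<^sub>\<beta>\<close> for \<open>\<alpha>\<close>, \<open>\<beta>\<close> of equal range, which is therefore in \<open>X\<^sup>-\<^sup>1 X\<close>; conversely each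
  nonempty map in \<open>X\<^sup>-\<^sup>1 X\<close> comes from a zigzag of length two (\<open>carrier_ZM_lcat\<close>). The theorem then
  follows from a general principle (\<open>morita_equivalent_partial_injections\<close>): a set \<open>X\<close> of partial
  injections for which \<open>X X\<^sup>-\<^sup>1\<close> is an inverse semigroup and \<open>X X\<^sup>-\<^sup>1 X \<subseteq> X\<close> provides an
  equivalence between \<open>X X\<^sup>-\<^sup>1\<close> and \<open>X\<^sup>-\<^sup>1 X\<close>, since with composition as both actions and
  \<open>x y\<^sup>-\<^sup>1\<close>, \<open>x\<^sup>-\<^sup>1 y\<close> as pairings the axioms are associativity and \<open>x x\<^sup>-\<^sup>1 x = x\<close>.
\<close>

section \<open>Partial injections\<close>

abbreviation pinj :: "('b \<rightharpoonup> 'c) \<Rightarrow> bool" where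
  "pinj f \<equiv> inj_on f (dom f)"

text \<open>This is \<open>pinverse\<close> with domain and codomain of different types, as needed for maps from the
  category to the semigroup.\<close>

definition pinv :: "('b \<rightharpoonup> 'c) \<Rightarrow> ('c \<rightharpoonup> 'b)" where
  "pinv f = (\<lambda>y. if y \<in> ran f then Some (THE x. f x = Some y) else None)"

lemma pinverse_eq_pinv: "pinverse = pinv"
  by (simp add: fun_eq_iff pinverse_def pinv_def)

lemma pinjI: "(\<And>x y z. f x = Some z \<Longrightarrow> f y = Some z \<Longrightarrow> x = y) \<Longrightarrow> pinj f"
  by (auto simp: inj_on_def dom_def)

lemma pinjD: "pinj f \<Longrightarrow> f x = Some z \<Longrightarrow> f y = Some z \<Longrightarrow> x = y"
  by (auto simp: inj_on_def dom_def)

lemma map_comp_assoc: "(f \<circ>\<^sub>m g) \<circ>\<^sub>m k = f \<circ>\<^sub>m (g \<circ>\<^sub>m k)"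
  by (auto simp: fun_eq_iff map_comp_def split: option.split)

lemma map_comp_Some [simp]: "f \<circ>\<^sub>m Some = f"
  by (auto simp: fun_eq_iff map_comp_def)

lemma Some_map_comp [simp]: "Some \<circ>\<^sub>m f = f"
  by (auto simp: fun_eq_iff map_comp_def split: option.split)

lemma map_eqI: "(\<And>x y. f x = Some y \<longleftrightarrow> g x = Some y) \<Longrightarrow> f = g"
  by (metis ext option.exhaust)

lemma pinv_eq_Some_iff:
  assumes "pinj f"
  shows "pinv f y = Some x \<longleftrightarrow> f x = Some y"
proof
  assume "pinv f y = Some x"
  then have "y \<in> ran f" "x = (THE x. f x = Some y)"
    by (auto simp: pinv_def split: if_splits)
  then obtain x' where x': "f x' = Some y" by (auto simp: ran_def)
  have "x' = (THE x. f x = Some y)"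
    by (rule the_equality[symmetric]) (use x' pinjD[OF assms] in auto)
  then show "f x = Some y" using x' \<open>x = _\<close> by simp
next
  assume a: "f x = Some y"
  have "(THE x. f x = Some y) = x"
    by (rule the_equality) (use a pinjD[OF assms] in auto)
  then show "pinv f y = Some x" using a by (auto simp: pinv_def ran_def)
qed

lemma pinj_comp: "pinj f \<Longrightarrow> pinj g \<Longrightarrow> pinj (f \<circ>\<^sub>m g)"
  by (rule pinjI) (auto simp: map_comp_Some_iff dest: pinjD)

lemma pinj_pinv: "pinj f \<Longrightarrow> pinj (pinv f)"
  by (rule pinjI) (simp add: pinv_eq_Some_iff)

lemma pinv_pinv: "pinj f \<Longrightarrow> pinv (pinv f) = f"
  by (rule map_eqI) (simp add: pinv_eq_Some_iff pinj_pinv)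

lemma pinv_comp: "pinj f \<Longrightarrow> pinj g \<Longrightarrow> pinv (f \<circ>\<^sub>m g) = pinv g \<circ>\<^sub>m pinv f"
  by (rule map_eqI) (auto simp: pinv_eq_Some_iff pinj_comp map_comp_Some_iff)

lemma comp_pinv_comp: "pinj f \<Longrightarrow> f \<circ>\<^sub>m (pinv f \<circ>\<^sub>m f) = f"
  by (rule map_eqI) (auto simp: pinv_eq_Some_iff map_comp_Some_iff dest: pinjD)

lemma pinv_comp_pinv: "pinj f \<Longrightarrow> pinv f \<circ>\<^sub>m (f \<circ>\<^sub>m pinv f) = pinv f"
  using comp_pinv_comp[OF pinj_pinv, of f] by (simp add: pinv_pinv)

text \<open>Partial injections have unique inverses. This identifies \<open>star\<close> both in a semigroup of partial
  injections and in the image of a representation by partial injections.\<close>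

lemma pinv_unique:
  assumes "pinj f" "pinj g" and fgf: "f \<circ>\<^sub>m (g \<circ>\<^sub>m f) = f" and gfg: "g \<circ>\<^sub>m (f \<circ>\<^sub>m g) = g"
  shows "g = pinv f"
proof (rule map_eqI)
  fix y x
  have "f x = Some y" if "g y = Some x"
  proof -
    have "(g \<circ>\<^sub>m (f \<circ>\<^sub>m g)) y = Some x" using gfg that by simp
    then show ?thesis using that assms(2) by (auto simp: map_comp_Some_iff dest: pinjD)
  qed
  moreover have "g y = Some x" if "f x = Some y"
  proof -
    have "(f \<circ>\<^sub>m (g \<circ>\<^sub>m f)) x = Some y" using fgf that by simp
    then show ?thesis using that assms(1) by (auto simp: map_comp_Some_iff dest: pinjD)
  qed
  ultimately show "g y = Some x \<longleftrightarrow> pinv f y = Some x"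
    using assms(1) by (auto simp: pinv_eq_Some_iff)
qed

section \<open>Inverse semigroups\<close>

context inverse_semigroup
begin

abbreviation inverse_of (\<open>_\<^sup>\<star>\<close> [1000] 999) where
  "x\<^sup>\<star> \<equiv> star S x"

definition idems where
  "idems = {e \<in> carrier S. e \<cdot> e = e}"

declare mult_closed [simp, intro]

lemma is_inverse_star: "x \<in> carrier S \<Longrightarrow> is_inverse S x (x\<^sup>\<star>)"
  unfolding star_def by (rule theI') (rule ex1_inverse)

lemma star_closed [simp, intro]: "x \<in> carrier S \<Longrightarrow> x\<^sup>\<star> \<in> carrier S"
  using is_inverse_star by (auto simp: is_inverse_def)

lemma star_eqI:
  assumes x: "x \<in> carrier S" and y: "y \<in> carrier S"
    and xyx: "x \<cdot> (y \<cdot> x) = x" and yxy: "y \<cdot> (x \<cdot> y) = y"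
  shows "x\<^sup>\<star> = y"
proof -
  have "is_inverse S x y"
    unfolding is_inverse_def mult_assoc[OF x y x] mult_assoc[OF y x y] using y xyx yxy by blast
  then show ?thesis
    using ex1_inverse[OF x] is_inverse_star[OF x] by blast
qed

lemma mult_star_mult [simp]:
  assumes x: "x \<in> carrier S" shows "x \<cdot> (x\<^sup>\<star> \<cdot> x) = x"
  using is_inverse_star[OF x] mult_assoc[of x "x\<^sup>\<star>" x] x by (simp add: is_inverse_def)

lemma star_mult_star [simp]:
  assumes x: "x \<in> carrier S" shows "x\<^sup>\<star> \<cdot> (x \<cdot> x\<^sup>\<star>) = x\<^sup>\<star>"
  using is_inverse_star[OF x] mult_assoc[of "x\<^sup>\<star>" x "x\<^sup>\<star>"] x by (simp add: is_inverse_def)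

lemma mult_star_mult_left [simp]:
  assumes x: "x \<in> carrier S" and y: "y \<in> carrier S"
  shows "x \<cdot> (x\<^sup>\<star> \<cdot> (x \<cdot> y)) = x \<cdot> y"
proof -
  have "x \<cdot> (x\<^sup>\<star> \<cdot> x) \<cdot> y = x \<cdot> (x\<^sup>\<star> \<cdot> (x \<cdot> y))"
    using x y by (simp add: mult_assoc del: mult_star_mult)
  then show ?thesis using x by simp
qed

lemma star_mult_star_left [simp]:
  assumes x: "x \<in> carrier S" and y: "y \<in> carrier S"
  shows "x\<^sup>\<star> \<cdot> (x \<cdot> (x\<^sup>\<star> \<cdot> y)) = x\<^sup>\<star> \<cdot> y"
proof -
  have "x\<^sup>\<star> \<cdot> (x \<cdot> x\<^sup>\<star>) \<cdot> y = x\<^sup>\<star> \<cdot> (x \<cdot> (x\<^sup>\<star> \<cdot> y))"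
    using x y by (simp add: mult_assoc del: star_mult_star)
  then show ?thesis using x by simp
qed

lemma star_star [simp]: "x \<in> carrier S \<Longrightarrow> (x\<^sup>\<star>)\<^sup>\<star> = x"
  by (rule star_eqI) simp_all

lemma idemI: "e \<in> carrier S \<Longrightarrow> e \<cdot> e = e \<Longrightarrow> e \<in> idems"
  by (simp add: idems_def)

lemma idemsD [simp, dest]: "e \<in> idems \<Longrightarrow> e \<in> carrier S"
  by (simp add: idems_def)

lemma idem [simp]: "e \<in> idems \<Longrightarrow> e \<cdot> e = e"
  unfolding idems_def by blast

lemma idem_left [simp]: "e \<in> idems \<Longrightarrow> x \<in> carrier S \<Longrightarrow> e \<cdot> (e \<cdot> x) = e \<cdot> x"
  by (simp flip: mult_assoc)

lemma idem_star [simp]: "e \<in> idems \<Longrightarrow> e\<^sup>\<star> = e"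
  by (rule star_eqI) simp_all

lemma star_mult_idem [simp]: "x \<in> carrier S \<Longrightarrow> x\<^sup>\<star> \<cdot> x \<in> idems"
  and mult_star_idem [simp]: "x \<in> carrier S \<Longrightarrow> x \<cdot> x\<^sup>\<star> \<in> idems"
  by (rule idemI; simp add: mult_assoc)+

text \<open>Let \<open>x\<close> be the inverse of \<open>e f\<close>. Since \<open>f x e\<close> is an inverse of \<open>e f\<close> as well, it equals \<open>x\<close>, and
  this makes \<open>x\<close> idempotent. Idempotents are their own inverses, so \<open>e f = x\<close>.\<close>

lemma idem_mult_idem:
  assumes e: "e \<in> idems" and f: "f \<in> idems"
  shows "e \<cdot> f \<in> idems"
proof -
  define x where "x = (e \<cdot> f)\<^sup>\<star>"
  have c: "e \<in> carrier S" "f \<in> carrier S" "x \<in> carrier S" using e f by (auto simp: x_def)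
  have 1: "e \<cdot> (f \<cdot> (x \<cdot> (e \<cdot> f))) = e \<cdot> f"
    using mult_star_mult[of "e \<cdot> f"] c unfolding x_def[symmetric] by (simp add: mult_assoc)
  have 2: "x \<cdot> (e \<cdot> (f \<cdot> x)) = x"
    using star_mult_star[of "e \<cdot> f"] c unfolding x_def[symmetric] by (simp add: mult_assoc)
  have 3: "x \<cdot> (e \<cdot> (f \<cdot> (x \<cdot> e))) = x \<cdot> e"
    using arg_cong[OF 2, of "\<lambda>t. t \<cdot> e"] c by (simp add: mult_assoc)
  have fxe: "f \<cdot> (x \<cdot> e) = x"
    using star_eqI[of "e \<cdot> f" "f \<cdot> (x \<cdot> e)"] c e f 1 2 3
    unfolding x_def[symmetric] by (simp add: mult_assoc)
  have "x \<cdot> x = (f \<cdot> (x \<cdot> e)) \<cdot> (f \<cdot> (x \<cdot> e))" by (simp only: fxe)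
  also have "\<dots> = f \<cdot> (x \<cdot> (e \<cdot> (f \<cdot> (x \<cdot> e))))" using c by (simp add: mult_assoc)
  also have "\<dots> = f \<cdot> (x \<cdot> e)" by (simp only: 3)
  also have "\<dots> = x" by (rule fxe)
  finally have xx: "x \<cdot> x = x" .
  have "x \<in> idems" using c(3) xx by (rule idemI)
  moreover have "x\<^sup>\<star> = e \<cdot> f" unfolding x_def by (rule star_star) (use c in simp)
  ultimately have "e \<cdot> f = x" using idem_star[of x] by (simp only:)
  then show ?thesis using \<open>x \<in> idems\<close> by simp
qed

text \<open>Both \<open>e f\<close> and \<open>f e\<close> are inverses of the idempotent \<open>e f\<close>.\<close>

lemma idem_commute:
  assumes e: "e \<in> idems" and f: "f \<in> idems"
  shows "e \<cdot> f = f \<cdot> e"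
proof -
  have c: "e \<in> carrier S" "f \<in> carrier S" using e f by auto
  have efef: "a \<cdot> (b \<cdot> (a \<cdot> b)) = a \<cdot> b" if "a \<in> idems" "b \<in> idems" for a b
    using idem[OF idem_mult_idem[OF that]] mult_assoc[of a b "a \<cdot> b"] that by simp
  have "(e \<cdot> f)\<^sup>\<star> = f \<cdot> e"
  proof (rule star_eqI)
    show "e \<cdot> f \<cdot> (f \<cdot> e \<cdot> (e \<cdot> f)) = e \<cdot> f"
      using c e f efef[OF e f] by (simp add: mult_assoc)
    show "f \<cdot> e \<cdot> (e \<cdot> f \<cdot> (f \<cdot> e)) = f \<cdot> e"
      using c e f efef[OF f e] by (simp add: mult_assoc)
  qed (use c in simp_all)
  then show ?thesis using idem_mult_idem[OF e f] by simp
qed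

lemma idem_left_commute:
  "e \<in> idems \<Longrightarrow> f \<in> idems \<Longrightarrow> x \<in> carrier S \<Longrightarrow> e \<cdot> (f \<cdot> x) = f \<cdot> (e \<cdot> x)"
  using idem_commute[of e f] by (simp flip: mult_assoc)

text \<open>The commutation of \<open>x x\<^sup>*\<close> with \<open>y\<^sup>* y\<close>, in the right-associated form to which products
  are simplified.\<close>

lemma projections_commute:
  assumes "x \<in> carrier S" "y \<in> carrier S" "w \<in> carrier S"
  shows "x \<cdot> (x\<^sup>\<star> \<cdot> (y\<^sup>\<star> \<cdot> (y \<cdot> w))) = y\<^sup>\<star> \<cdot> (y \<cdot> (x \<cdot> (x\<^sup>\<star> \<cdot> w)))"
  using idem_left_commute[of "x \<cdot> x\<^sup>\<star>" "y\<^sup>\<star> \<cdot> y" w] assms by (simp add: mult_assoc)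

lemma star_mult:
  assumes x: "x \<in> carrier S" and y: "y \<in> carrier S"
  shows "(x \<cdot> y)\<^sup>\<star> = y\<^sup>\<star> \<cdot> x\<^sup>\<star>"
proof (rule star_eqI)
  show "x \<cdot> y \<cdot> (y\<^sup>\<star> \<cdot> x\<^sup>\<star> \<cdot> (x \<cdot> y)) = x \<cdot> y"
    using x y projections_commute[of y x y] by (simp add: mult_assoc)
  show "y\<^sup>\<star> \<cdot> x\<^sup>\<star> \<cdot> (x \<cdot> y \<cdot> (y\<^sup>\<star> \<cdot> x\<^sup>\<star>)) = y\<^sup>\<star> \<cdot> x\<^sup>\<star>"
    using x y projections_commute[of y x "x\<^sup>\<star>"] by (simp add: mult_assoc)
qed (use x y in simp_all)

end

section \<open>Morita equivalence from a set of partial injections\<close>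

text \<open>Here \<open>h\<close> identifies \<open>S\<close> with \<open>X X\<^sup>-\<^sup>1\<close>. The inclusion \<open>X X\<^sup>-\<^sup>1 X \<subseteq> X\<close>, which is the hypothesis
  \<open>hX\<close>, makes \<open>X\<^sup>-\<^sup>1 X\<close> closed under composition; as it is also closed under inversion of maps, it is
  an inverse semigroup, acting on \<open>X\<close> from the right.\<close>

lemma morita_equivalent_partial_injections:
  fixes S :: "('a, 'm) semigrp_scheme" and T :: "('c \<rightharpoonup> 'c, 'n) semigrp_scheme"
    and h :: "'a \<Rightarrow> ('b \<rightharpoonup> 'b)" and X :: "('c \<rightharpoonup> 'b) set"
  assumes "inverse_semigroup S"
    and h_pinj: "\<And>s. s \<in> carrier S \<Longrightarrow> pinj (h s)"
    and h_inj: "inj_on h (carrier S)"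
    and h_mult: "\<And>s t. s \<in> carrier S \<Longrightarrow> t \<in> carrier S \<Longrightarrow> h (s \<cdot>\<^bsub>S\<^esub> t) = h s \<circ>\<^sub>m h t"
    and X_pinj: "\<And>x. x \<in> X \<Longrightarrow> pinj x"
    and hX: "\<And>s x. s \<in> carrier S \<Longrightarrow> x \<in> X \<Longrightarrow> h s \<circ>\<^sub>m x \<in> X"
    and h_image: "h ` carrier S = {x \<circ>\<^sub>m pinv y | x y. x \<in> X \<and> y \<in> X}"
    and T_carrier: "carrier T = {pinv x \<circ>\<^sub>m y | x y. x \<in> X \<and> y \<in> X}"
    and T_mult: "mult T = (\<circ>\<^sub>m)"
  shows "morita_equivalent S T"
proof -
  interpret S: inverse_semigroup S by fact
  note [simp] = map_comp_assoc T_mult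
  have T_pinj: "pinj t" if "t \<in> carrier T" for t
    using that X_pinj by (auto simp: T_carrier intro!: pinj_comp pinj_pinv)
  have XXX: "x \<circ>\<^sub>m (pinv y \<circ>\<^sub>m z) \<in> X" if xyz: "x \<in> X" "y \<in> X" "z \<in> X" for x y z
  proof -
    obtain s where "s \<in> carrier S" "x \<circ>\<^sub>m pinv y = h s"
      using h_image xyz by blast
    then have "(x \<circ>\<^sub>m pinv y) \<circ>\<^sub>m z \<in> X" using hX xyz by simp
    then show ?thesis by simp
  qed
  have XT: "x \<circ>\<^sub>m t \<in> X" if "x \<in> X" "t \<in> carrier T" for x t
    using that XXX by (auto simp: T_carrier)
  have T_closed: "t \<circ>\<^sub>m u \<in> carrier T" if "t \<in> carrier T" and u: "u \<in> carrier T" for t u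
  proof -
    obtain x y where t: "t = pinv x \<circ>\<^sub>m y" and xy: "x \<in> X" "y \<in> X"
      using \<open>t \<in> carrier T\<close> by (auto simp: T_carrier)
    then show ?thesis using XT[OF \<open>y \<in> X\<close> u] by (auto simp: T_carrier)
  qed
  have T_pinv: "pinv t \<in> carrier T" if "t \<in> carrier T" for t
    using that X_pinj by (fastforce simp: T_carrier pinv_comp pinj_pinv pinv_pinv)
  have is_inverse_T: "is_inverse T t u \<longleftrightarrow> u = pinv t" if t: "t \<in> carrier T" for t u
  proof
    assume "is_inverse T t u"
    then show "u = pinv t"
      using t T_pinj by (intro pinv_unique) (auto simp: is_inverse_def)
  next
    assume "u = pinv t"
    then show "is_inverse T t u"
      using t T_pinj T_pinv by (simp add: is_inverse_def comp_pinv_comp pinv_comp_pinv)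
  qed
  have inv_T: "inverse_semigroup T"
    by unfold_locales (simp_all add: T_closed is_inverse_T)
  have star_T: "star T t = pinv t" if "t \<in> carrier T" for t
    using that by (simp add: star_def is_inverse_T)
  have h_star: "h (star S s) = pinv (h s)" if s: "s \<in> carrier S" for s
    using s by (intro pinv_unique) (simp_all add: h_pinj h_mult[symmetric])
  define lip where "lip x y = inv_into (carrier S) h (x \<circ>\<^sub>m pinv y)"
    for x y :: "'c \<rightharpoonup> 'b"
  have lip_in: "lip x y \<in> carrier S" and h_lip: "h (lip x y) = x \<circ>\<^sub>m pinv y"
    if "x \<in> X" "y \<in> X" for x y
  proof -
    have "x \<circ>\<^sub>m pinv y \<in> h ` carrier S" using that h_image by auto
    then show "lip x y \<in> carrier S" "h (lip x y) = x \<circ>\<^sub>m pinv y"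
      unfolding lip_def by (rule inv_into_into, rule f_inv_into_f)
  qed
  have lip_eqI: "lip x y = s" if "s \<in> carrier S" "x \<in> X" "y \<in> X" "x \<circ>\<^sub>m pinv y = h s" for x y s
    using that h_inj by (simp add: lip_def)
  have "morita_context S T X (\<lambda>s x. h s \<circ>\<^sub>m x) (\<lambda>x t. x \<circ>\<^sub>m t) lip (\<lambda>x y. pinv x \<circ>\<^sub>m y)"
  proof (intro morita_context.intro morita_context_axioms.intro)
    show "(\<lambda>(x, y). lip x y) ` (X \<times> X) = carrier S"
    proof
      show "(\<lambda>(x, y). lip x y) ` (X \<times> X) \<subseteq> carrier S" using lip_in by auto
      show "carrier S \<subseteq> (\<lambda>(x, y). lip x y) ` (X \<times> X)"
      proof
        fix s assume s: "s \<in> carrier S"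
        then have "h s \<in> {x \<circ>\<^sub>m pinv y | x y. x \<in> X \<and> y \<in> X}"
          unfolding h_image[symmetric] by (rule imageI)
        then obtain x y where "x \<in> X" "y \<in> X" "x \<circ>\<^sub>m pinv y = h s" by auto
        then show "s \<in> (\<lambda>(x, y). lip x y) ` (X \<times> X)"
          using lip_eqI[OF s] by force
      qed
    qed
    show "(\<lambda>(x, y). pinv x \<circ>\<^sub>m y) ` (X \<times> X) = carrier T"
      by (auto simp: T_carrier)
    show "lip (h s \<circ>\<^sub>m x) y = s \<cdot>\<^bsub>S\<^esub> lip x y" if "s \<in> carrier S" "x \<in> X" "y \<in> X" for s x y
      using that by (intro lip_eqI) (simp_all add: lip_in hX h_mult h_lip)
    show "lip y x = star S (lip x y)" if "x \<in> X" "y \<in> X" for x y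
      using that
      by (intro lip_eqI) (simp_all add: lip_in h_star h_lip pinv_comp X_pinj pinj_pinv pinv_pinv)
    show "pinv y \<circ>\<^sub>m x = star T (pinv x \<circ>\<^sub>m y)" if "x \<in> X" "y \<in> X" for x y
    proof -
      have "pinv x \<circ>\<^sub>m y \<in> carrier T" using that by (auto simp: T_carrier)
      then show ?thesis using that by (simp add: star_T pinv_comp X_pinj pinj_pinv pinv_pinv)
    qed
  qed (simp_all add: \<open>inverse_semigroup S\<close> inv_T hX XT h_mult h_lip comp_pinv_comp X_pinj)
  then show ?thesis by (rule morita_equivalentI)
qed

section \<open>The Wagner--Preston maps on the nonzero elements\<close>

context inverse_semigroup_with_zero
begin

definition zero (\<open>\<zero>\<close>) where
  "zero = (THE z. z \<in> carrier S \<and> (\<forall>x\<in>carrier S. z \<cdot> x = z \<and> x \<cdot> z = z))"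

lemma zero_props: "\<zero> \<in> carrier S \<and> (\<forall>x\<in>carrier S. \<zero> \<cdot> x = \<zero> \<and> x \<cdot> \<zero> = \<zero>)"
  unfolding zero_def
proof (rule theI')
  show "\<exists>!z. z \<in> carrier S \<and> (\<forall>x\<in>carrier S. z \<cdot> x = z \<and> x \<cdot> z = z)"
    using ex_zero by metis
qed

lemma zero_closed [simp]: "\<zero> \<in> carrier S"
  and zero_mult [simp]: "x \<in> carrier S \<Longrightarrow> \<zero> \<cdot> x = \<zero>"
  and mult_zero [simp]: "x \<in> carrier S \<Longrightarrow> x \<cdot> \<zero> = \<zero>"
  using zero_props by auto

lemma zero_idem [simp]: "\<zero> \<in> idems"
  by (rule idemI) simp_all

lemma star_mult_nonzero:
  assumes "s \<in> carrier S" "s \<noteq> \<zero>" shows "s\<^sup>\<star> \<cdot> s \<noteq> \<zero>"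
  using mult_star_mult[of s] assms by (metis mult_zero)

text \<open>The factor \<open>t\<close> can be recovered from \<open>s t\<close>.\<close>

lemma mult_nonzero:
  assumes "s \<in> carrier S" "t \<in> carrier S" "t \<noteq> \<zero>" "s\<^sup>\<star> \<cdot> (s \<cdot> t) = t"
  shows "s \<cdot> t \<noteq> \<zero>"
  using assms by (metis mult_zero star_closed)

text \<open>Leaving out the point zero makes \<open>\<lambda>\<^sub>0\<close> the empty map, so that the zero of \<open>S\<close>
  represents the zero of the semigroup of partial injections.\<close>

definition lam :: "'a \<Rightarrow> ('a \<rightharpoonup> 'a)" where
  "lam s x = (if x \<in> carrier S \<and> x \<noteq> \<zero> \<and> s\<^sup>\<star> \<cdot> (s \<cdot> x) = x then Some (s \<cdot> x) else None)"

lemma lam_eq_Some_iff: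
  "lam s x = Some y \<longleftrightarrow> x \<in> carrier S \<and> x \<noteq> \<zero> \<and> s\<^sup>\<star> \<cdot> (s \<cdot> x) = x \<and> y = s \<cdot> x"
  by (auto simp: lam_def)

lemma pinj_lam: "pinj (lam s)"
  by (rule pinjI) (metis lam_eq_Some_iff)

lemma lam_zero: "lam \<zero> = Map.empty"
  by (auto simp: fun_eq_iff lam_def)

text \<open>Only the domains need an argument: \<open>t\<^sup>* s\<^sup>* s t x = x\<close> forces \<open>t\<^sup>* t x = x\<close>, and, since \<open>t t\<^sup>*\<close>
  commutes with \<open>s\<^sup>* s\<close>, also \<open>s\<^sup>* s t x = t x\<close>.\<close>

lemma lam_mult:
  assumes s: "s \<in> carrier S" and t: "t \<in> carrier S"
  shows "lam (s \<cdot> t) = lam s \<circ>\<^sub>m lam t"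
proof -
  have iff: "(s \<cdot> t)\<^sup>\<star> \<cdot> (s \<cdot> t \<cdot> x) = x
      \<longleftrightarrow> t\<^sup>\<star> \<cdot> (t \<cdot> x) = x \<and> s\<^sup>\<star> \<cdot> (s \<cdot> (t \<cdot> x)) = t \<cdot> x" (is "?l \<longleftrightarrow> ?r")
    if x: "x \<in> carrier S" for x
  proof
    assume l: ?l
    then have l': "t\<^sup>\<star> \<cdot> (s\<^sup>\<star> \<cdot> (s \<cdot> (t \<cdot> x))) = x"
      using s t x by (simp add: star_mult mult_assoc)
    then have 1: "t\<^sup>\<star> \<cdot> (t \<cdot> x) = x"
      using s t x star_mult_star_left[of t "s\<^sup>\<star> \<cdot> (s \<cdot> (t \<cdot> x))"] by simp
    have "t \<cdot> x = t \<cdot> (t\<^sup>\<star> \<cdot> (s\<^sup>\<star> \<cdot> (s \<cdot> (t \<cdot> x))))" using l' by simp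
    also have "\<dots> = s\<^sup>\<star> \<cdot> (s \<cdot> (t \<cdot> x))"
      using s t x projections_commute[of t s "t \<cdot> x"] by simp
    finally show ?r using 1 by simp
  next
    assume ?r
    then show ?l using s t x by (simp add: star_mult mult_assoc)
  qed
  show ?thesis
  proof (rule map_eqI)
    fix x y
    have "t \<cdot> x \<noteq> \<zero>" if "x \<in> carrier S" "x \<noteq> \<zero>" "t\<^sup>\<star> \<cdot> (t \<cdot> x) = x"
      using that t by (intro mult_nonzero)
    then show "lam (s \<cdot> t) x = Some y \<longleftrightarrow> (lam s \<circ>\<^sub>m lam t) x = Some y"
      using s t iff[of x] by (auto simp: lam_eq_Some_iff map_comp_Some_iff mult_assoc)
  qed
qed

lemma pinv_lam: "s \<in> carrier S \<Longrightarrow> pinv (lam s) = lam (s\<^sup>\<star>)"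
  by (rule pinv_unique[symmetric]) (simp_all add: pinj_lam lam_mult[symmetric])

text \<open>If \<open>s \<noteq> 0\<close>, evaluation at \<open>s\<^sup>* s\<close> gives \<open>t s\<^sup>* s = s\<close>, that is, \<open>s \<le> t\<close> in the natural order,
  which is also true of \<open>s = 0\<close>; by symmetry \<open>s = t\<close>.\<close>

lemma inj_lam: "inj_on lam (carrier S)"
proof (rule inj_onI)
  have below: "t \<cdot> (s\<^sup>\<star> \<cdot> s) = s"
    if s: "s \<in> carrier S" and t: "t \<in> carrier S" and eq: "lam s = lam t" for s t
  proof (cases "s = \<zero>")
    case False
    then have "lam s (s\<^sup>\<star> \<cdot> s) = Some s"
      using s star_mult_nonzero by (simp add: lam_def mult_assoc)
    then show ?thesis by (simp add: eq lam_eq_Some_iff)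
  qed (use s t in simp)
  fix s t assume s: "s \<in> carrier S" and t: "t \<in> carrier S" and eq: "lam s = lam t"
  have "t = s \<cdot> (t\<^sup>\<star> \<cdot> t)" using below[OF t s] eq by simp
  also have "\<dots> = t \<cdot> (s\<^sup>\<star> \<cdot> s) \<cdot> (t\<^sup>\<star> \<cdot> t)" using below[OF s t] eq by simp
  also have "\<dots> = t \<cdot> ((t\<^sup>\<star> \<cdot> t) \<cdot> (s\<^sup>\<star> \<cdot> s))"
    using s t idem_commute[of "t\<^sup>\<star> \<cdot> t" "s\<^sup>\<star> \<cdot> s"] by (simp add: mult_assoc)
  also have "\<dots> = t \<cdot> (s\<^sup>\<star> \<cdot> s)" using s t by (simp add: mult_assoc)
  also have "\<dots> = s" by (rule below[OF s t eq])
  finally show "s = t" by simp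
qed

text \<open>The nonzero \<open>x\<close> with \<open>q x = x\<close> are the second components of the morphisms with range \<open>q\<close>. For
  \<open>q = 0\<close> there are none, so the zero can be admitted as an index without harm.\<close>

definition eps :: "'a \<Rightarrow> ('a \<times> 'a \<rightharpoonup> 'a)" where
  "eps q = (\<lambda>(p, x). if p = q \<and> x \<in> carrier S \<and> x \<noteq> \<zero> \<and> q \<cdot> x = x then Some x else None)"

lemma eps_eq_Some_iff:
  "eps q c = Some y \<longleftrightarrow> c = (q, y) \<and> y \<in> carrier S \<and> y \<noteq> \<zero> \<and> q \<cdot> y = y"
  by (cases c) (auto simp: eps_def)

lemma pinj_eps: "pinj (eps q)"
  by (rule pinjI) (simp add: eps_eq_Some_iff)

lemma eps_comp_pinv_eps:
  "q \<in> idems \<Longrightarrow> eps q \<circ>\<^sub>m pinv (eps r) = (if q = r then lam q else lam \<zero>)"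
  by (rule map_eqI)
    (auto simp: map_comp_Some_iff pinv_eq_Some_iff pinj_eps eps_eq_Some_iff lam_zero lam_eq_Some_iff)

lemma lam_comp_eps: "q \<in> idems \<Longrightarrow> lam q \<circ>\<^sub>m eps q = eps q"
  using comp_pinv_comp[OF pinj_eps, of q] eps_comp_pinv_eps[of q q]
  by (simp add: map_comp_assoc[symmetric])

lemma pinv_eps_comp_lam: "q \<in> idems \<Longrightarrow> pinv (eps q) \<circ>\<^sub>m lam q = pinv (eps q)"
  using pinv_comp_pinv[OF pinj_eps, of q] eps_comp_pinv_eps[of q q] by simp

text \<open>This is the set \<open>X\<close> that carries the equivalence. As \<open>a\<close> or \<open>q\<close> may be zero, it contains the empty
  map even if the category is empty, which is the case \<open>S = {0}\<close>.\<close>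

definition fibre_maps :: "('a \<times> 'a \<rightharpoonup> 'a) set" where
  "fibre_maps = {lam a \<circ>\<^sub>m eps q | a q. a \<in> carrier S \<and> q \<in> idems}"

lemma eps_in_fibre_maps: "q \<in> idems \<Longrightarrow> eps q \<in> fibre_maps"
  unfolding fibre_maps_def using lam_comp_eps[of q] idemsD[of q] by (metis (mono_tags, lifting) mem_Collect_eq)

lemma pinj_fibre_map: "x \<in> fibre_maps \<Longrightarrow> pinj x"
  by (auto simp: fibre_maps_def intro!: pinj_comp pinj_lam pinj_eps)

lemma lam_comp_fibre_map:
  assumes "s \<in> carrier S" "x \<in> fibre_maps"
  shows "lam s \<circ>\<^sub>m x \<in> fibre_maps"
proof -
  obtain a q where "x = lam a \<circ>\<^sub>m eps q" "a \<in> carrier S" "q \<in> idems"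
    using assms(2) by (auto simp: fibre_maps_def)
  moreover from this have "lam s \<circ>\<^sub>m x = lam (s \<cdot> a) \<circ>\<^sub>m eps q"
    using assms(1) by (simp add: lam_mult map_comp_assoc)
  ultimately show ?thesis using assms(1) by (auto simp: fibre_maps_def)
qed

lemma fibre_maps_comp_pinv: "lam ` carrier S = {x \<circ>\<^sub>m pinv y | x y. x \<in> fibre_maps \<and> y \<in> fibre_maps}"
proof (intro equalityI subsetI)
  fix f assume "f \<in> lam ` carrier S"
  then obtain s where s: "s \<in> carrier S" "f = lam s" by auto
  let ?q = "s\<^sup>\<star> \<cdot> s"
  have q: "?q \<in> idems" using s by simp
  have "f = lam s \<circ>\<^sub>m lam ?q" using s lam_mult[of s ?q] by simp
  also have "\<dots> = (lam s \<circ>\<^sub>m eps ?q) \<circ>\<^sub>m pinv (eps ?q)"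
    unfolding map_comp_assoc eps_comp_pinv_eps[OF q] by simp
  finally have "f = (lam s \<circ>\<^sub>m eps ?q) \<circ>\<^sub>m pinv (eps ?q)" .
  moreover have "lam s \<circ>\<^sub>m eps ?q \<in> fibre_maps" using s q unfolding fibre_maps_def by blast
  ultimately show "f \<in> {x \<circ>\<^sub>m pinv y | x y. x \<in> fibre_maps \<and> y \<in> fibre_maps}"
    using eps_in_fibre_maps[OF q] by blast
next
  fix f assume "f \<in> {x \<circ>\<^sub>m pinv y | x y. x \<in> fibre_maps \<and> y \<in> fibre_maps}"
  then obtain a q b r where *: "a \<in> carrier S" "q \<in> idems" "b \<in> carrier S" "r \<in> idems"
    and "f = (lam a \<circ>\<^sub>m eps q) \<circ>\<^sub>m pinv (lam b \<circ>\<^sub>m eps r)"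
    by (auto simp: fibre_maps_def)
  then have "f = lam a \<circ>\<^sub>m ((eps q \<circ>\<^sub>m pinv (eps r)) \<circ>\<^sub>m lam (b\<^sup>\<star>))"
    by (simp add: pinv_comp pinj_lam pinj_eps pinv_lam map_comp_assoc)
  also have "\<dots> = lam (a \<cdot> ((if q = r then q else \<zero>) \<cdot> b\<^sup>\<star>))"
    using * by (simp add: eps_comp_pinv_eps lam_mult)
  finally have "f = lam (a \<cdot> ((if q = r then q else \<zero>) \<cdot> b\<^sup>\<star>))" .
  moreover have "a \<cdot> ((if q = r then q else \<zero>) \<cdot> b\<^sup>\<star>) \<in> carrier S" using * by simp
  ultimately show "f \<in> lam ` carrier S" by blast
qed

text \<open>The matrix blocks between two fibres: \<open>X\<^sup>-\<^sup>1 X\<close>.\<close>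

definition blocks :: "('a \<times> 'a \<rightharpoonup> 'a \<times> 'a) set" where
  "blocks = {pinv x \<circ>\<^sub>m y | x y. x \<in> fibre_maps \<and> y \<in> fibre_maps}"

text \<open>In \<open>(\<lambda>\<^sub>a \<epsilon>\<^sub>p)\<^sup>-\<^sup>1 \<lambda>\<^sub>b \<epsilon>\<^sub>q\<close> the two middle factors combine to \<open>\<lambda>\<^sub>c\<close> with \<open>c = a\<^sup>* b\<close>.\<close>

lemma blocks_eq:
  "blocks = {pinv (eps p) \<circ>\<^sub>m (lam c \<circ>\<^sub>m eps q) | p c q. p \<in> idems \<and> c \<in> carrier S \<and> q \<in> idems}"
proof (intro equalityI subsetI)
  fix f assume "f \<in> blocks"
  then obtain a q b r where *: "a \<in> carrier S" "q \<in> idems" "b \<in> carrier S" "r \<in> idems"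
    and "f = pinv (lam a \<circ>\<^sub>m eps q) \<circ>\<^sub>m (lam b \<circ>\<^sub>m eps r)"
    by (auto simp: fibre_maps_def blocks_def)
  then have "f = pinv (eps q) \<circ>\<^sub>m (lam (a\<^sup>\<star> \<cdot> b) \<circ>\<^sub>m eps r)"
    by (simp add: pinv_comp pinj_lam pinj_eps pinv_lam map_comp_assoc lam_mult)
  then show "f \<in> {pinv (eps p) \<circ>\<^sub>m (lam c \<circ>\<^sub>m eps q) | p c q.
      p \<in> idems \<and> c \<in> carrier S \<and> q \<in> idems}" using * by blast
next
  fix f assume "f \<in> {pinv (eps p) \<circ>\<^sub>m (lam c \<circ>\<^sub>m eps q) | p c q.
      p \<in> idems \<and> c \<in> carrier S \<and> q \<in> idems}"
  then obtain p c q where *: "p \<in> idems" "c \<in> carrier S" "q \<in> idems"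
    and f: "f = pinv (eps p) \<circ>\<^sub>m (lam c \<circ>\<^sub>m eps q)" by blast
  have "lam c \<circ>\<^sub>m eps q \<in> fibre_maps" using * unfolding fibre_maps_def by blast
  then show "f \<in> blocks" using eps_in_fibre_maps[OF *(1)] f unfolding blocks_def by blast
qed

text \<open>If the blocks are not adjacent, that is, if \<open>q \<noteq> q'\<close>, the composite is empty; it is then a block
  with middle factor \<open>\<lambda>\<^sub>0\<close>.\<close>

lemma blocks_comp:
  assumes "f \<in> blocks" "g \<in> blocks"
  shows "f \<circ>\<^sub>m g \<in> blocks"
proof -
  obtain p a q where f: "p \<in> idems" "a \<in> carrier S" "q \<in> idems"
    "f = pinv (eps p) \<circ>\<^sub>m (lam a \<circ>\<^sub>m eps q)" using assms(1) by (auto simp: blocks_eq)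
  obtain q' b r where g: "q' \<in> idems" "b \<in> carrier S" "r \<in> idems"
    "g = pinv (eps q') \<circ>\<^sub>m (lam b \<circ>\<^sub>m eps r)" using assms(2) by (auto simp: blocks_eq)
  have "f \<circ>\<^sub>m g = pinv (eps p) \<circ>\<^sub>m (lam a \<circ>\<^sub>m ((eps q \<circ>\<^sub>m pinv (eps q')) \<circ>\<^sub>m (lam b \<circ>\<^sub>m eps r)))"
    using f g by (simp add: map_comp_assoc)
  also have "\<dots> = pinv (eps p) \<circ>\<^sub>m (lam (a \<cdot> ((if q = q' then q else \<zero>) \<cdot> b)) \<circ>\<^sub>m eps r)"
    using f g by (simp add: eps_comp_pinv_eps lam_mult map_comp_assoc)
  finally have "f \<circ>\<^sub>m g
      = pinv (eps p) \<circ>\<^sub>m (lam (a \<cdot> ((if q = q' then q else \<zero>) \<cdot> b)) \<circ>\<^sub>m eps r)" .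
  moreover have "a \<cdot> ((if q = q' then q else \<zero>) \<cdot> b) \<in> carrier S" using f g by simp
  ultimately show ?thesis using f(1) g(3) unfolding blocks_eq by blast
qed

section \<open>The left cancellative category of an inverse semigroup with zero\<close>

text \<open>An object \<open>e\<close> is the identity morphism \<open>(e, e)\<close>. The component \<open>e\<close> of \<open>(e, s)\<close> records the range, which
  may be any idempotent above \<open>s s\<^sup>*\<close>.\<close>

definition lcat :: "('a \<times> 'a) cat" where
  "lcat = \<lparr>mor = {(e, s). e \<in> idems \<and> s \<in> carrier S \<and> s \<noteq> \<zero> \<and> e \<cdot> s = s},
     rng = (\<lambda>(e, s). (e, e)),
     src = (\<lambda>(e, s). (s\<^sup>\<star> \<cdot> s, s\<^sup>\<star> \<cdot> s)),
     cmp = (\<lambda>(e, s) (f, t). (e, s \<cdot> t))\<rparr>"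

lemma lcat_simps [simp]:
  "(e, s) \<in> mor lcat \<longleftrightarrow> e \<in> idems \<and> s \<in> carrier S \<and> s \<noteq> \<zero> \<and> e \<cdot> s = s"
  "rng lcat (e, s) = (e, e)"
  "src lcat (e, s) = (s\<^sup>\<star> \<cdot> s, s\<^sup>\<star> \<cdot> s)"
  "cmp lcat (e, s) (f, t) = (e, s \<cdot> t)"
  by (simp_all add: lcat_def)

lemma lcat_left_cancellative: "left_cancellative_category lcat"
proof unfold_locales
  fix a assume a: "a \<in> mor lcat"
  obtain e s where a_eq: "a = (e, s)" by (cases a)
  have *: "e \<in> idems" "s \<in> carrier S" "s \<noteq> \<zero>" "e \<cdot> s = s" "e \<noteq> \<zero>"
    using a by (auto simp: a_eq)
  show "rng lcat a \<in> mor lcat" "src lcat a \<in> mor lcat" "rng lcat (rng lcat a) = rng lcat a"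
    "src lcat (rng lcat a) = rng lcat a" "rng lcat (src lcat a) = src lcat a"
    "src lcat (src lcat a) = src lcat a" "cmp lcat (rng lcat a) a = a"
    "cmp lcat a (src lcat a) = a"
    using * by (simp_all add: a_eq star_mult_nonzero)
  fix b assume b: "b \<in> mor lcat" and ab: "src lcat a = rng lcat b"
  obtain f t where b_eq: "b = (f, t)" by (cases b)
  have **: "t \<in> carrier S" "t \<noteq> \<zero>" "f = s\<^sup>\<star> \<cdot> s" "s\<^sup>\<star> \<cdot> (s \<cdot> t) = t"
    using b ab * by (auto simp: a_eq b_eq mult_assoc)
  show "cmp lcat a b \<in> mor lcat" "rng lcat (cmp lcat a b) = rng lcat a"
    "src lcat (cmp lcat a b) = src lcat b"
    using * ** mult_nonzero[of s t] mult_assoc[of e s t]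
    by (simp_all add: a_eq b_eq) (simp add: star_mult mult_assoc)
  fix c assume c: "c \<in> mor lcat"
  obtain g u where c_eq: "c = (g, u)" by (cases c)
  show "cmp lcat (cmp lcat a b) c = cmp lcat a (cmp lcat b c)" if "src lcat b = rng lcat c"
    using * ** c that by (simp add: a_eq b_eq c_eq mult_assoc)
  show "b = c" if "src lcat a = rng lcat c" "cmp lcat a b = cmp lcat a c"
  proof -
    have "g = s\<^sup>\<star> \<cdot> s" "s\<^sup>\<star> \<cdot> (s \<cdot> u) = u" "s \<cdot> t = s \<cdot> u"
      using that c * by (auto simp: a_eq b_eq c_eq mult_assoc)
    then show ?thesis using ** by (metis b_eq c_eq)
  qed
qed

text \<open>A pair \<open>(e, u)\<close> with \<open>s s\<^sup>* u = u\<close> is the product of \<open>(e, s)\<close> with \<open>(s\<^sup>* s, s\<^sup>* u)\<close>.\<close>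

lemma right_ideal_lcat:
  assumes "(e, s) \<in> mor lcat"
  shows "right_ideal lcat (e, s)
    = {(e, u) | u. u \<in> carrier S \<and> u \<noteq> \<zero> \<and> s \<cdot> (s\<^sup>\<star> \<cdot> u) = u}" (is "_ = ?R")
proof (intro equalityI subsetI)
  fix c assume "c \<in> right_ideal lcat (e, s)"
  then obtain t where "c = (e, s \<cdot> t)" "t \<in> carrier S" "t \<noteq> \<zero>" "s\<^sup>\<star> \<cdot> (s \<cdot> t) = t"
    using assms by (auto simp: right_ideal_def mult_assoc)
  then show "c \<in> ?R" using assms mult_nonzero[of s t] by auto
next
  fix c assume "c \<in> ?R"
  then obtain u where u: "c = (e, u)" "u \<in> carrier S" "u \<noteq> \<zero>" "s \<cdot> (s\<^sup>\<star> \<cdot> u) = u" by auto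
  then have "(s\<^sup>\<star> \<cdot> s, s\<^sup>\<star> \<cdot> u) \<in> mor lcat"
    using assms mult_nonzero[of "s\<^sup>\<star>" u] by (simp add: mult_assoc)
  moreover have "c = cmp lcat (e, s) (s\<^sup>\<star> \<cdot> s, s\<^sup>\<star> \<cdot> u)" using u by simp
  moreover have "src lcat (e, s) = rng lcat (s\<^sup>\<star> \<cdot> s, s\<^sup>\<star> \<cdot> u)" by simp
  ultimately show "c \<in> right_ideal lcat (e, s)"
    unfolding right_ideal_def by blast
qed

lemma lcat_singly_aligned: "singly_aligned_category lcat"
proof (intro singly_aligned_category.intro singly_aligned_category_axioms.intro)
  fix a b
  assume a: "a \<in> mor lcat" and b: "b \<in> mor lcat"
    and ne: "right_ideal lcat a \<inter> right_ideal lcat b \<noteq> {}"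
  obtain e s where a_eq: "a = (e, s)" by (cases a)
  obtain f t where b_eq: "b = (f, t)" by (cases b)
  have *: "e \<in> idems" "s \<in> carrier S" "e \<cdot> s = s" "t \<in> carrier S"
    using a b by (auto simp: a_eq b_eq)
  obtain u where u: "f = e" "u \<in> carrier S" "u \<noteq> \<zero>" "s \<cdot> (s\<^sup>\<star> \<cdot> u) = u" "t \<cdot> (t\<^sup>\<star> \<cdot> u) = u"
    using ne right_ideal_lcat a b by (auto simp: a_eq b_eq)
  \<comment> \<open>The meet of the two range projections generates the intersection.\<close>
  define g where "g = s \<cdot> s\<^sup>\<star> \<cdot> (t \<cdot> t\<^sup>\<star>)"
  have g: "g \<in> idems" using * unfolding g_def by (simp add: idem_mult_idem)
  have gx: "g \<cdot> x = s \<cdot> (s\<^sup>\<star> \<cdot> (t \<cdot> (t\<^sup>\<star> \<cdot> x)))" if "x \<in> carrier S" for x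
    using * that by (simp add: g_def mult_assoc)
  have gx_iff: "g \<cdot> x = x \<longleftrightarrow> s \<cdot> (s\<^sup>\<star> \<cdot> x) = x \<and> t \<cdot> (t\<^sup>\<star> \<cdot> x) = x" if x: "x \<in> carrier S" for x
  proof
    assume gxx: "g \<cdot> x = x"
    have "g \<cdot> x = t \<cdot> (t\<^sup>\<star> \<cdot> (s \<cdot> (s\<^sup>\<star> \<cdot> x)))"
      using gx[OF x] idem_left_commute[of "s \<cdot> s\<^sup>\<star>" "t \<cdot> t\<^sup>\<star>" x] * x by (simp add: mult_assoc)
    then show "s \<cdot> (s\<^sup>\<star> \<cdot> x) = x \<and> t \<cdot> (t\<^sup>\<star> \<cdot> x) = x"
      using gx[OF x] gxx * x
        mult_star_mult_left[of s "s\<^sup>\<star> \<cdot> (t \<cdot> (t\<^sup>\<star> \<cdot> x))"]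
        mult_star_mult_left[of t "t\<^sup>\<star> \<cdot> (s \<cdot> (s\<^sup>\<star> \<cdot> x))"]
      by simp
  qed (use x gx in simp)
  have "g \<noteq> \<zero>" using gx_iff[of u] u by auto
  moreover have "e \<cdot> g = g" using * u mult_assoc[of e s "s\<^sup>\<star> \<cdot> (t \<cdot> t\<^sup>\<star>)"]
    by (simp add: g_def mult_assoc)
  ultimately have g_mor: "(e, g) \<in> mor lcat" using * g by simp
  have "right_ideal lcat a \<inter> right_ideal lcat b = right_ideal lcat (e, g)"
    using right_ideal_lcat[OF g_mor] right_ideal_lcat a b gx_iff g u(1)
    by (auto simp: a_eq b_eq)
  then show "\<exists>c\<in>mor lcat. right_ideal lcat a \<inter> right_ideal lcat b = right_ideal lcat c"
    using g_mor by blast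
qed (rule lcat_left_cancellative)

section \<open>The zigzag maps\<close>

lemma tau_lcat:
  assumes "(e, s) \<in> mor lcat"
  shows "tau lcat (e, s) = (\<lambda>x. Some (e, x)) \<circ>\<^sub>m (lam s \<circ>\<^sub>m eps (s\<^sup>\<star> \<cdot> s))"
proof (rule map_eqI)
  fix c d
  have "right_ideal lcat (src lcat (e, s))
      = {(s\<^sup>\<star> \<cdot> s, u) | u. u \<in> carrier S \<and> u \<noteq> \<zero> \<and> s\<^sup>\<star> \<cdot> (s \<cdot> u) = u}"
    using assms right_ideal_lcat[of "s\<^sup>\<star> \<cdot> s" "s\<^sup>\<star> \<cdot> s"] star_mult_nonzero[of s]
    by (auto simp: mult_assoc)
  then show "tau lcat (e, s) c = Some d
      \<longleftrightarrow> ((\<lambda>x. Some (e, x)) \<circ>\<^sub>m (lam s \<circ>\<^sub>m eps (s\<^sup>\<star> \<cdot> s))) c = Some d"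
    using assms
    by (auto simp: tau_def map_comp_Some_iff lam_eq_Some_iff eps_eq_Some_iff mult_assoc)
qed

text \<open>The injection \<open>x \<mapsto> (e, x)\<close> is common to both factors and cancels.\<close>

lemma pinv_tau_comp_tau:
  assumes "(e, s) \<in> mor lcat" "(e, t) \<in> mor lcat"
  shows "pinv (tau lcat (e, s)) \<circ>\<^sub>m tau lcat (e, t)
    = pinv (eps (s\<^sup>\<star> \<cdot> s)) \<circ>\<^sub>m (lam (s\<^sup>\<star> \<cdot> t) \<circ>\<^sub>m eps (t\<^sup>\<star> \<cdot> t))"
proof -
  define i :: "'a \<Rightarrow> ('a \<times> 'a) option" where "i = (\<lambda>x. Some (e, x))"
  have i: "pinj i" by (rule pinjI) (simp add: i_def)
  have "pinv i \<circ>\<^sub>m i = Some"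
  proof (rule map_eqI)
    fix x y
    have "(pinv i \<circ>\<^sub>m i) x = Some y \<longleftrightarrow> (\<exists>z. i x = Some z \<and> i y = Some z)"
      by (auto simp: map_comp_Some_iff pinv_eq_Some_iff[OF i])
    also have "\<dots> \<longleftrightarrow> Some x = Some y" by (auto simp: i_def)
    finally show "(pinv i \<circ>\<^sub>m i) x = Some y \<longleftrightarrow> Some x = Some y" .
  qed
  then have ii: "pinv i \<circ>\<^sub>m (i \<circ>\<^sub>m f) = f" for f :: "'a \<times> 'a \<rightharpoonup> 'a"
    by (simp add: map_comp_assoc[symmetric])
  have st: "s \<in> carrier S" "t \<in> carrier S" using assms by simp_all
  have "pinv (tau lcat (e, s)) \<circ>\<^sub>m tau lcat (e, t)
      = pinv (i \<circ>\<^sub>m (lam s \<circ>\<^sub>m eps (s\<^sup>\<star> \<cdot> s))) \<circ>\<^sub>m (i \<circ>\<^sub>m (lam t \<circ>\<^sub>m eps (t\<^sup>\<star> \<cdot> t)))"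
    using assms by (simp only: tau_lcat i_def)
  also have "\<dots> = pinv (eps (s\<^sup>\<star> \<cdot> s)) \<circ>\<^sub>m (lam (s\<^sup>\<star>) \<circ>\<^sub>m (lam t \<circ>\<^sub>m eps (t\<^sup>\<star> \<cdot> t)))"
    by (simp only: pinv_comp pinj_comp i pinj_lam pinj_eps pinv_lam st map_comp_assoc ii)
  also have "\<dots> = pinv (eps (s\<^sup>\<star> \<cdot> s)) \<circ>\<^sub>m (lam (s\<^sup>\<star> \<cdot> t) \<circ>\<^sub>m eps (t\<^sup>\<star> \<cdot> t))"
    by (simp only: lam_mult[OF star_closed[OF st(1)] st(2)] map_comp_assoc)
  finally show ?thesis .
qed

lemma zigzag_map_Cons:
  "zigzag_map C ((a, b) # zs) = (pinv (tau C a) \<circ>\<^sub>m tau C b) \<circ>\<^sub>m zigzag_map C zs"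
  by (simp add: zigzag_map_def pinverse_eq_pinv map_comp_assoc)

lemma zigzag_map_Nil: "zigzag_map C [] = Some"
  by (simp add: zigzag_map_def)

lemma pinv_tau_comp_tau_in_blocks:
  assumes "a \<in> mor lcat" "b \<in> mor lcat" "rng lcat a = rng lcat b"
  shows "pinv (tau lcat a) \<circ>\<^sub>m tau lcat b \<in> blocks"
proof -
  obtain e s where a: "a = (e, s)" by (cases a)
  obtain t where b: "b = (e, t)" using assms(3) by (cases b) (simp add: a)
  have st: "s \<in> carrier S" "t \<in> carrier S" using assms by (simp_all add: a b)
  then have "s\<^sup>\<star> \<cdot> s \<in> idems" "s\<^sup>\<star> \<cdot> t \<in> carrier S" "t\<^sup>\<star> \<cdot> t \<in> idems" by simp_all
  then show ?thesis
    using pinv_tau_comp_tau[of e s t] assms(1,2) unfolding a b blocks_eq by blast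
qed

lemma zigzag_map_in_blocks:
  assumes "zs \<noteq> []" "\<forall>(a, b) \<in> set zs. a \<in> mor lcat \<and> b \<in> mor lcat \<and> rng lcat a = rng lcat b"
  shows "zigzag_map lcat zs \<in> blocks"
  using assms
proof (induction zs rule: list_nonempty_induct)
  case (single ab)
  then show ?case
    by (cases ab) (simp add: zigzag_map_Cons zigzag_map_Nil pinv_tau_comp_tau_in_blocks)
next
  case (cons ab zs)
  then show ?case
    by (cases ab) (simp add: zigzag_map_Cons pinv_tau_comp_tau_in_blocks blocks_comp)
qed

lemma block_zero: "pinv (eps p) \<circ>\<^sub>m (lam \<zero> \<circ>\<^sub>m eps q) = Map.empty"
  by (simp add: fun_eq_iff lam_zero map_comp_def split: option.split)

text \<open>A single pair \<open>(\<alpha>, \<beta>)\<close> would need \<open>c = s\<^sup>* t\<close> with \<open>s\<^sup>* s = p\<close> and \<open>t\<^sup>* t = q\<close>, which may be impossible.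
  Two pairs that meet in the object \<open>c\<^sup>* c\<close> suffice: the second restricts the fibre over \<open>q\<close> to
  \<open>c\<^sup>* c\<close>, and the first is multiplication by \<open>c\<close>.\<close>

lemma carrier_ZM_lcat: "carrier (ZM lcat) = blocks"
proof -
  have "{zigzag_map lcat zs | zs. zigzag lcat zs} \<union> {Map.empty} = blocks"
  proof (intro equalityI subsetI)
    fix f assume "f \<in> {zigzag_map lcat zs | zs. zigzag lcat zs} \<union> {Map.empty}"
    moreover have "zigzag_map lcat zs \<in> blocks" if "zigzag lcat zs" for zs
      using that by (intro zigzag_map_in_blocks) (auto simp: zigzag_def)
    moreover have "Map.empty \<in> blocks"
      unfolding blocks_eq mem_Collect_eq
      by (intro exI[of _ \<zero>]) (simp add: block_zero)
    ultimately show "f \<in> blocks" by blast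
  next
    fix f assume "f \<in> blocks"
    then obtain p b q where *: "p \<in> idems" "b \<in> carrier S" "q \<in> idems"
      and f: "f = pinv (eps p) \<circ>\<^sub>m (lam b \<circ>\<^sub>m eps q)" by (auto simp: blocks_eq)
    \<comment> \<open>Replacing \<open>b\<close> by \<open>p b q\<close> leaves the map unchanged and makes \<open>(p, c)\<close> a morphism if \<open>c \<noteq> 0\<close>.\<close>
    define c where "c = p \<cdot> (b \<cdot> q)"
    have c: "c \<in> carrier S" "p \<cdot> c = c" "c \<cdot> q = c"
      using * by (simp_all add: c_def mult_assoc)
    have "f = (pinv (eps p) \<circ>\<^sub>m lam p) \<circ>\<^sub>m (lam b \<circ>\<^sub>m (lam q \<circ>\<^sub>m eps q))"
      unfolding f using * by (simp only: pinv_eps_comp_lam lam_comp_eps)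
    also have "\<dots> = pinv (eps p) \<circ>\<^sub>m (lam c \<circ>\<^sub>m eps q)"
      using * by (simp add: c_def lam_mult map_comp_assoc)
    finally have f_c: "f = pinv (eps p) \<circ>\<^sub>m (lam c \<circ>\<^sub>m eps q)" .
    show "f \<in> {zigzag_map lcat zs | zs. zigzag lcat zs} \<union> {Map.empty}"
    proof (cases "c = \<zero>")
      case True
      then show ?thesis using f_c block_zero by simp
    next
      case False
      let ?r = "c\<^sup>\<star> \<cdot> c"
      let ?zs = "[((p, p), (p, c)), ((q, ?r), (q, q))]"
      have "p \<noteq> \<zero>" "q \<noteq> \<zero>" using False c by auto
      moreover have "q \<cdot> ?r = ?r"
        using c * idem_commute[of q ?r] by (simp add: mult_assoc)
      ultimately have mor: "(p, p) \<in> mor lcat" "(p, c) \<in> mor lcat" "(q, ?r) \<in> mor lcat"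
          "(q, q) \<in> mor lcat"
        using * c False star_mult_nonzero by simp_all
      have "zigzag lcat ?zs"
        using mor * c unfolding zigzag_def by (auto simp: mult_assoc less_Suc_eq)
      moreover have "zigzag_map lcat ?zs = f"
      proof -
        have "zigzag_map lcat ?zs = pinv (eps p) \<circ>\<^sub>m
            (lam c \<circ>\<^sub>m ((eps ?r \<circ>\<^sub>m pinv (eps ?r)) \<circ>\<^sub>m (lam (?r \<cdot> q) \<circ>\<^sub>m eps q)))"
          using * c mor pinv_tau_comp_tau[of p p c] pinv_tau_comp_tau[of q ?r q]
          by (simp add: zigzag_map_Cons zigzag_map_Nil map_comp_assoc idem_star[OF star_mult_idem]
              idem[OF star_mult_idem])
        also have "\<dots> = pinv (eps p) \<circ>\<^sub>m (lam c \<circ>\<^sub>m (lam ?r \<circ>\<^sub>m (lam (?r \<cdot> q) \<circ>\<^sub>m eps q)))"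
          using c by (simp add: eps_comp_pinv_eps del: mult_star_mult)
        also have "\<dots> = pinv (eps p) \<circ>\<^sub>m (lam (c \<cdot> (?r \<cdot> (?r \<cdot> q))) \<circ>\<^sub>m eps q)"
          using * c lam_mult[of c "?r \<cdot> (?r \<cdot> q)"] lam_mult[of ?r "?r \<cdot> q"]
          by (simp only: map_comp_assoc mult_closed star_closed idemsD)
        also have "c \<cdot> (?r \<cdot> (?r \<cdot> q)) = c" using * c by (simp add: mult_assoc)
        finally show ?thesis using f_c by simp
      qed
      ultimately show ?thesis by blast
    qed
  qed
  then show ?thesis by (simp add: ZM_def)
qed

end

section \<open>The equivalence\<close>

theorem corollary6p2:
  fixes S :: "('a, 'm) semigrp_scheme"
  assumes "inverse_semigroup_with_zero S"
  shows "\<exists>C :: ('a \<times> 'a) cat. singly_aligned_category C \<and> morita_equivalent S (ZM C)"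
proof -
  interpret inverse_semigroup_with_zero S by fact
  have "morita_equivalent S (ZM lcat)"
  proof (rule morita_equivalent_partial_injections[where h = lam and X = fibre_maps])
    show "inverse_semigroup S" by unfold_locales
    show "carrier (ZM lcat) = {pinv x \<circ>\<^sub>m y | x y. x \<in> fibre_maps \<and> y \<in> fibre_maps}"
      by (simp add: carrier_ZM_lcat blocks_def)
    show "mult (ZM lcat) = (\<circ>\<^sub>m)" by (simp add: ZM_def partial_bijections_def)
  qed (simp_all add: pinj_lam inj_lam lam_mult pinj_fibre_map lam_comp_fibre_map fibre_maps_comp_pinv)
  then show ?thesis using lcat_singly_aligned by blast
qed

end
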